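(* Let $q(t),r(t)$ be holomorphic functions on a domain $B\subset\mathbb{C}$ with $q$ nowhere vanishing. The phase space $\mathcal{X}$ for the system $$\begin{aligned}\frac{dx}{dt}&=-q(t)x^2-r(t)xy-\frac{q'(t)}{2q(t)}x+y+\frac{r(t)}{2q(t)},\\ \frac{dy}{dt}&=-r(t)y^2-q(t)xy-\frac{q'(t)}{2q(t)}y+\frac12\end{aligned}$$ is the $2$-dimensional projective space: $(x,y)\in\mathbb{C}^2\subset\mathbb{P}^2$.
   Context: The embedding $\mathbb{C}^2\subset\mathbb{P}^2$ is $(x,y)=(z_1/z_0,z_2/z_0)$ for homogeneous coordinates $[z_0:z_1:z_2]$; $\mathbb{P}^2$ is covered by the charts $(x,y)$, $(X_1,Y_1)=(1/x,y/x)$, $(X_2,Y_2)=(x/y,1/y)$. That $\mathbb{P}^2$ is the phase space (space of initial conditions) means that, rewritten in each of these three charts, the system has right-hand sides polynomial in the chart coordinates with coefficients holomorphic in $t$ (so the system extends holomorphically to $\mathbb{P}^2\times B$), and every solution $(x(t),y(t))$ meromorphic near a point of $B$ extends holomorphically as a map into $\mathbb{P}^2$. *)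

theory Defs
  imports "HOL-Complex_Analysis.Complex_Analysis"
begin

section \<open>The complex projective plane\<close>

definition proj_rel :: "complex \<times> complex \<times> complex \<Rightarrow> complex \<times> complex \<times> complex \<Rightarrow> bool" where
  "proj_rel = (\<lambda>(z0, z1, z2) (w0, w1, w2).
     (z0, z1, z2) \<noteq> (0, 0, 0) \<and>
     (\<exists>c. c \<noteq> 0 \<and> w0 = c * z0 \<and> w1 = c * z1 \<and> w2 = c * z2))"

lemma proj_rel_part_equivp: "part_equivp proj_rel"
proof (rule part_equivpI)
  show "\<exists>z. proj_rel z z"
    by (rule exI[of _ "(1, 0, 0)"]) (auto simp: proj_rel_def intro: exI[of _ 1])
  show "symp proj_rel"
  proof (rule sympI)
    fix z w assume "proj_rel z w"
    moreover obtain z0 z1 z2 w0 w1 w2 where "z = (z0, z1, z2)" "w = (w0, w1, w2)"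
      by (metis prod.exhaust)
    ultimately obtain c where "c \<noteq> 0" "w = (c * z0, c * z1, c * z2)" "z = (z0, z1, z2)"
      "z \<noteq> (0, 0, 0)"
      by (auto simp: proj_rel_def)
    then show "proj_rel w z"
      by (auto simp: proj_rel_def intro!: exI[of _ "inverse c"])
  qed
  show "transp proj_rel"
  proof (rule transpI)
    fix u v w assume "proj_rel u v" "proj_rel v w"
    then show "proj_rel u w"
      by (auto simp: proj_rel_def split: prod.splits)
  qed
qed

text \<open>Points are the classes \<open>[z0 : z1 : z2]\<close> of nonzero triples up to scaling.\<close>

quotient_type proj_plane = "complex \<times> complex \<times> complex" / partial: proj_rel
  by (rule proj_rel_part_equivp)

text \<open>The chart \<open>Chart0\<close> is the affine plane with coordinates
  \<open>(x, y) = (z1/z0, z2/z0)\<close>, the chart \<open>Chart1\<close> has coordinates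
  \<open>(1/x, y/x) = (z0/z1, z2/z1)\<close> and \<open>Chart2\<close> has coordinates \<open>(x/y, 1/y) = (z1/z2, z0/z2)\<close>.\<close>

datatype chart = Chart0 | Chart1 | Chart2

lift_definition chart_dom :: "chart \<Rightarrow> proj_plane \<Rightarrow> bool" is
  "\<lambda>k (z0, z1, z2). case k of Chart0 \<Rightarrow> z0 \<noteq> 0 | Chart1 \<Rightarrow> z1 \<noteq> 0 | Chart2 \<Rightarrow> z2 \<noteq> 0"
  by (auto simp: proj_rel_def split: chart.splits)

text \<open>Only meaningful on \<open>chart_dom\<close>; elsewhere a quotient has denominator \<open>0\<close>.\<close>

lift_definition chart_coord :: "chart \<Rightarrow> proj_plane \<Rightarrow> complex \<times> complex" is
  "\<lambda>k (z0, z1, z2). case k of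
      Chart0 \<Rightarrow> (z1 / z0, z2 / z0)
    | Chart1 \<Rightarrow> (z0 / z1, z2 / z1)
    | Chart2 \<Rightarrow> (z1 / z2, z0 / z2)"
  by (auto simp: proj_rel_def split: chart.splits)

text \<open>The inverse of \<open>chart_coord k\<close>.\<close>

lift_definition chart_point :: "chart \<Rightarrow> complex \<times> complex \<Rightarrow> proj_plane" is
  "\<lambda>k (a, b). case k of
      Chart0 \<Rightarrow> (1, a, b)
    | Chart1 \<Rightarrow> (a, 1, b)
    | Chart2 \<Rightarrow> (b, a, 1)"
  by (auto simp: proj_rel_def split: chart.splits intro: exI[of _ 1])

lemma chart_dom_chart_point: "chart_dom k (chart_point k u)"
  by transfer (auto split: chart.splits)

lemma chart_coord_chart_point: "chart_coord k (chart_point k u) = u"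
  by transfer (auto split: chart.splits)

lemma chart_point_chart_coord: "chart_dom k p \<Longrightarrow> chart_point k (chart_coord k p) = p"
proof (transfer, goal_cases)
  case (1 k p)
  obtain a b c where p: "p = (a, b, c)" by (metis prod.exhaust)
  show ?case using 1
    by (cases k) (auto simp: p proj_rel_def)
qed

lemma charts_cover: "\<exists>k. chart_dom k p"
proof (transfer, goal_cases)
  case (1 p)
  then obtain a b c where p: "p = (a, b, c)" "a \<noteq> 0 \<or> b \<noteq> 0 \<or> c \<noteq> 0"
    by (auto simp: proj_rel_def)
  then show ?case
    by (auto intro: exI[of _ Chart0] exI[of _ Chart1] exI[of _ Chart2])
qed

lemma affine_chart_dom:
  "chart_dom Chart0 (chart_point Chart0 (x, y))"
  "chart_dom Chart1 (chart_point Chart0 (x, y)) \<longleftrightarrow> x \<noteq> 0"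
  "chart_dom Chart2 (chart_point Chart0 (x, y)) \<longleftrightarrow> y \<noteq> 0"
  by (transfer; simp)+

lemma affine_chart_coord:
  "chart_coord Chart1 (chart_point Chart0 (x, y)) = (1 / x, y / x)"
  "chart_coord Chart2 (chart_point Chart0 (x, y)) = (x / y, 1 / y)"
  by (transfer; simp)+

definition holomorphic_into_plane :: "complex set \<Rightarrow> (complex \<Rightarrow> proj_plane) \<Rightarrow> bool" where
  "holomorphic_into_plane U \<Phi> \<longleftrightarrow>
     (\<forall>t\<in>U. \<exists>k V. open V \<and> t \<in> V \<and> V \<subseteq> U \<and> (\<forall>s\<in>V. chart_dom k (\<Phi> s)) \<and>
        (\<lambda>s. fst (chart_coord k (\<Phi> s))) holomorphic_on V \<and>
        (\<lambda>s. snd (chart_coord k (\<Phi> s))) holomorphic_on V)"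

section \<open>Systems of two differential equations\<close>

text \<open>\<open>F t (a, b)\<close> is the pair of right-hand sides of the system
  \<open>(a', b') = F t (a, b)\<close>.\<close>

type_synonym ode_rhs = "complex \<Rightarrow> complex \<times> complex \<Rightarrow> complex \<times> complex"

definition polynomial_with_holomorphic_coeffs ::
    "complex set \<Rightarrow> (complex \<Rightarrow> complex \<times> complex \<Rightarrow> complex) \<Rightarrow> bool" where
  "polynomial_with_holomorphic_coeffs B f \<longleftrightarrow>
     (\<exists>(n::nat) c. (\<forall>i\<le>n. \<forall>j\<le>n. c i j holomorphic_on B) \<and>
        (\<forall>t\<in>B. \<forall>a b. f t (a, b) = (\<Sum>i\<le>n. \<Sum>j\<le>n. c i j t * a ^ i * b ^ j)))"

definition polynomial_system :: "complex set \<Rightarrow> ode_rhs \<Rightarrow> bool" where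
  "polynomial_system B F \<longleftrightarrow>
     polynomial_with_holomorphic_coeffs B (\<lambda>t u. fst (F t u)) \<and>
     polynomial_with_holomorphic_coeffs B (\<lambda>t u. snd (F t u))"

text \<open>The system \<open>F\<close> in the coordinates \<open>u\<close> of chart \<open>j\<close> becomes the system \<open>G\<close> in the
  coordinates \<open>v = \<tau>(u)\<close> of chart \<open>k\<close>: by the chain rule, \<open>v' = D\<tau>(u) (F t u)\<close> along solutions.\<close>

definition rewritten_as :: "complex set \<Rightarrow> chart \<Rightarrow> ode_rhs \<Rightarrow> chart \<Rightarrow> ode_rhs \<Rightarrow> bool" where
  "rewritten_as B j F k G \<longleftrightarrow>
     (\<forall>t\<in>B. \<forall>u. chart_dom k (chart_point j u) \<longrightarrow>
        (\<exists>D. ((\<lambda>v. chart_coord k (chart_point j v)) has_derivative D) (at u) \<and>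
             G t (chart_coord k (chart_point j u)) = D (F t u)))"

text \<open>The library's meromorphic functions may take arbitrary values at poles and at removable
  singularities, so the equations are imposed where both components are analytic.\<close>

definition meromorphic_solution ::
    "ode_rhs \<Rightarrow> complex set \<Rightarrow> (complex \<Rightarrow> complex) \<Rightarrow> (complex \<Rightarrow> complex) \<Rightarrow> bool" where
  "meromorphic_solution F U x y \<longleftrightarrow>
     x meromorphic_on U \<and> y meromorphic_on U \<and>
     (\<forall>t\<in>U. x analytic_on {t} \<and> y analytic_on {t} \<longrightarrow>
        (x has_field_derivative fst (F t (x t, y t))) (at t) \<and>
        (y has_field_derivative snd (F t (x t, y t))) (at t))"

definition extends_into_plane ::
    "complex set \<Rightarrow> (complex \<Rightarrow> complex) \<Rightarrow> (complex \<Rightarrow> complex) \<Rightarrow> bool" where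
  "extends_into_plane U x y \<longleftrightarrow>
     (\<exists>\<Phi>. holomorphic_into_plane U \<Phi> \<and>
        (\<forall>t\<in>U. x analytic_on {t} \<and> y analytic_on {t} \<longrightarrow> \<Phi> t = chart_point Chart0 (x t, y t)))"

text \<open>The projective plane is the phase space (space of initial conditions) of the system \<open>F\<close>
  given in the affine chart over the time domain \<open>B\<close>. The requirement on all pairs of charts says
  that the three systems glue to one on the projective plane times \<open>B\<close>.\<close>

definition phase_space_is_proj_plane :: "complex set \<Rightarrow> ode_rhs \<Rightarrow> bool" where
  "phase_space_is_proj_plane B F \<longleftrightarrow>
     (\<exists>G. (\<forall>t\<in>B. \<forall>u. G Chart0 t u = F t u) \<and>
          (\<forall>k. polynomial_system B (G k)) \<and>
          (\<forall>j k. rewritten_as B j (G j) k (G k))) \<and>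
     (\<forall>U x y. open U \<and> U \<subseteq> B \<and> meromorphic_solution F U x y \<longrightarrow> extends_into_plane U x y)"

end

theory Submission
  imports Defs
begin

text \<open>The system is the projectivisation of the linear system
  \<open>z0' = q z1 + r z2\<close>, \<open>z1' = r/(2q) z0 - q'/(2q) z1 + z2\<close>, \<open>z2' = z0/2 - q'/(2q) z2\<close>:
  in each affine chart a linear system induces a quadratic one, and these agree on overlaps.
  Solutions extend because any pair of meromorphic functions of one variable extends
  holomorphically into the plane: at each point one of the three homogeneous coordinates
  \<open>1, x, y\<close> has minimal order, and the quotients by it have removable singularities.\<close>

section \<open>Transition maps between the charts\<close>

lemma chart_dom_chart_point_iff:
  "chart_dom Chart0 (chart_point Chart1 (a, b)) \<longleftrightarrow> a \<noteq> 0"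
  "chart_dom Chart2 (chart_point Chart1 (a, b)) \<longleftrightarrow> b \<noteq> 0"
  "chart_dom Chart0 (chart_point Chart2 (a, b)) \<longleftrightarrow> b \<noteq> 0"
  "chart_dom Chart1 (chart_point Chart2 (a, b)) \<longleftrightarrow> a \<noteq> 0"
  by (transfer; simp)+

lemma chart_coord_chart_point_transition:
  "chart_coord Chart0 (chart_point Chart1 (a, b)) = (1 / a, b / a)"
  "chart_coord Chart2 (chart_point Chart1 (a, b)) = (1 / b, a / b)"
  "chart_coord Chart0 (chart_point Chart2 (a, b)) = (a / b, 1 / b)"
  "chart_coord Chart1 (chart_point Chart2 (a, b)) = (b / a, 1 / a)"
  by (transfer; simp)+

lemma chart_point_Chart1_inverse:
  assumes "x \<noteq> 0"
  shows "chart_point Chart1 (1 / x, y / x) = chart_point Chart0 (x, y)"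
  using chart_point_chart_coord[of Chart1 "chart_point Chart0 (x, y)"] assms
  by (simp add: affine_chart_dom affine_chart_coord)

lemma chart_point_Chart2_inverse:
  assumes "y \<noteq> 0"
  shows "chart_point Chart2 (x / y, 1 / y) = chart_point Chart0 (x, y)"
  using chart_point_chart_coord[of Chart2 "chart_point Chart0 (x, y)"] assms
  by (simp add: affine_chart_dom affine_chart_coord)

section \<open>Derivatives of the transition maps\<close>

lemma has_derivative_inverse_fst:
  fixes u :: "complex \<times> complex"
  assumes "fst u \<noteq> 0"
  shows "((\<lambda>v. 1 / fst v) has_derivative (\<lambda>h. - fst h / (fst u)\<^sup>2)) (at u)"
  by (rule derivative_eq_intros refl assms)+ (use assms in \<open>auto simp: power2_eq_square field_simps\<close>)

lemma has_derivative_inverse_snd: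
  fixes u :: "complex \<times> complex"
  assumes "snd u \<noteq> 0"
  shows "((\<lambda>v. 1 / snd v) has_derivative (\<lambda>h. - snd h / (snd u)\<^sup>2)) (at u)"
  by (rule derivative_eq_intros refl assms)+ (use assms in \<open>auto simp: power2_eq_square field_simps\<close>)

lemma has_derivative_snd_div_fst:
  fixes u :: "complex \<times> complex"
  assumes "fst u \<noteq> 0"
  shows "((\<lambda>v. snd v / fst v) has_derivative
           (\<lambda>h. (snd h * fst u - snd u * fst h) / (fst u)\<^sup>2)) (at u)"
  by (rule derivative_eq_intros refl assms)+ (use assms in \<open>auto simp: power2_eq_square field_simps\<close>)

lemma has_derivative_fst_div_snd:
  fixes u :: "complex \<times> complex"
  assumes "snd u \<noteq> 0"
  shows "((\<lambda>v. fst v / snd v) has_derivative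
           (\<lambda>h. (fst h * snd u - fst u * snd h) / (snd u)\<^sup>2)) (at u)"
  by (rule derivative_eq_intros refl assms)+ (use assms in \<open>auto simp: power2_eq_square field_simps\<close>)

text \<open>Both coordinates of a transition map are scalar quotients, so the derivative required by
  \<open>rewritten_as\<close> is assembled from two scalar ones.\<close>

lemma rewritten_asI:
  assumes "\<And>u. chart_dom k (chart_point j u) \<Longrightarrow>
      ((\<lambda>v. fst (chart_coord k (chart_point j v))) has_derivative D1 u) (at u)"
    and "\<And>u. chart_dom k (chart_point j u) \<Longrightarrow>
      ((\<lambda>v. snd (chart_coord k (chart_point j v))) has_derivative D2 u) (at u)"
    and "\<And>t u. t \<in> B \<Longrightarrow> chart_dom k (chart_point j u) \<Longrightarrow>
      G t (chart_coord k (chart_point j u)) = (D1 u (F t u), D2 u (F t u))"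
  shows "rewritten_as B j F k G"
  unfolding rewritten_as_def
proof (intro ballI allI impI)
  fix t u assume t: "t \<in> B" and u: "chart_dom k (chart_point j u)"
  have "((\<lambda>v. chart_coord k (chart_point j v)) has_derivative (\<lambda>h. (D1 u h, D2 u h))) (at u)"
    using has_derivative_Pair[OF assms(1,2)[OF u]] by simp
  then show "\<exists>D. ((\<lambda>v. chart_coord k (chart_point j v)) has_derivative D) (at u) \<and>
      G t (chart_coord k (chart_point j u)) = D (F t u)"
    using assms(3)[OF t u] by blast
qed

lemma rewritten_as_refl: "rewritten_as B k F k F"
  unfolding rewritten_as_def by (auto simp: chart_coord_chart_point intro!: exI[of _ "\<lambda>h. h"])

section \<open>Projectivised linear systems\<close>

text \<open>The system induced in the charts by \<open>z' = A z\<close>, where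
  \<open>A i j\<close> is the coefficient of \<open>zj\<close> in \<open>zi'\<close>.\<close>

fun riccati :: "(nat \<Rightarrow> nat \<Rightarrow> complex \<Rightarrow> complex) \<Rightarrow> chart \<Rightarrow> ode_rhs" where
  "riccati A Chart0 t (x, y) =
     (let l = A 0 0 t + A 0 1 t * x + A 0 2 t * y in
       (A 1 0 t + A 1 1 t * x + A 1 2 t * y - x * l, A 2 0 t + A 2 1 t * x + A 2 2 t * y - y * l))"
| "riccati A Chart1 t (x, y) =
     (let l = A 1 0 t * x + A 1 1 t + A 1 2 t * y in
       (A 0 0 t * x + A 0 1 t + A 0 2 t * y - x * l, A 2 0 t * x + A 2 1 t + A 2 2 t * y - y * l))"
| "riccati A Chart2 t (x, y) =
     (let l = A 2 0 t * y + A 2 1 t * x + A 2 2 t in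
       (A 1 0 t * y + A 1 1 t * x + A 1 2 t - x * l, A 0 0 t * y + A 0 1 t * x + A 0 2 t - y * l))"

text \<open>Packages six named coefficients into a square array with bound 2 on each
  exponent.\<close>

lemma polynomial_with_holomorphic_coeffs_quadratic:
  assumes "c0 holomorphic_on B" "c1 holomorphic_on B" "c2 holomorphic_on B"
    and "c3 holomorphic_on B" "c4 holomorphic_on B" "c5 holomorphic_on B"
    and "\<And>t a b. t \<in> B \<Longrightarrow>
      f t (a, b) = c0 t + c1 t * a + c2 t * b + c3 t * a\<^sup>2 + c4 t * a * b + c5 t * b\<^sup>2"
  shows "polynomial_with_holomorphic_coeffs B f"
proof -
  \<comment> \<open>The square of exponents also contains monomials of total degree above 2, such as
    \<open>a ^ 2 * b\<close>; these fall under the default 0.\<close>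
  define c where "c i j =
    (if (i, j) = (0, 0) then c0 else if (i, j) = (1, 0) then c1 else if (i, j) = (0, 1) then c2
     else if (i, j) = (2, 0) then c3 else if (i, j) = (1, 1) then c4
     else if (i, j) = (0, 2) then c5 else (\<lambda>_. 0))" for i j :: nat
  have "c i j holomorphic_on B" for i j
    using assms(1-6) by (simp add: c_def)
  moreover have "f t (a, b) = (\<Sum>i\<le>2. \<Sum>j\<le>2. c i j t * a ^ i * b ^ j)" if "t \<in> B" for t a b
    using assms(7)[OF that] by (simp add: c_def numeral_2_eq_2 algebra_simps)
  ultimately show ?thesis
    unfolding polynomial_with_holomorphic_coeffs_def by blast
qed

text \<open>In each chart \<open>l\<close> is the logarithmic derivative of the homogeneous
  coordinate normalised to 1, and the terms \<open>- x * l\<close> and \<open>- y * l\<close> are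
  the only source of quadratic monomials. Expanding them gives the coefficients listed below:
  differences of diagonal entries, single entries up to sign, and 0.\<close>

lemma polynomial_system_riccati:
  assumes A: "\<And>i j. A i j holomorphic_on B"
  shows "polynomial_system B (riccati A k)"
proof -
  note h = holomorphic_on_diff[OF A A] holomorphic_on_minus[OF A] A holomorphic_on_const[of 0]
  show ?thesis
  proof (cases k)
    case Chart0
    show ?thesis
      unfolding Chart0 polynomial_system_def
    proof
      show "polynomial_with_holomorphic_coeffs B (\<lambda>t u. fst (riccati A Chart0 t u))"
        by (rule polynomial_with_holomorphic_coeffs_quadratic
            [where ?c0.0="A 1 0" and ?c1.0="\<lambda>t. A 1 1 t - A 0 0 t" and ?c2.0="A 1 2"
              and ?c3.0="\<lambda>t. - A 0 1 t" and ?c4.0="\<lambda>t. - A 0 2 t" and ?c5.0="\<lambda>_. 0"])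
          (rule h | simp add: Let_def algebra_simps power2_eq_square)+
      show "polynomial_with_holomorphic_coeffs B (\<lambda>t u. snd (riccati A Chart0 t u))"
        by (rule polynomial_with_holomorphic_coeffs_quadratic
            [where ?c0.0="A 2 0" and ?c1.0="A 2 1" and ?c2.0="\<lambda>t. A 2 2 t - A 0 0 t"
              and ?c3.0="\<lambda>_. 0" and ?c4.0="\<lambda>t. - A 0 1 t" and ?c5.0="\<lambda>t. - A 0 2 t"])
          (rule h | simp add: Let_def algebra_simps power2_eq_square)+
    qed
  next
    case Chart1
    show ?thesis
      unfolding Chart1 polynomial_system_def
    proof
      show "polynomial_with_holomorphic_coeffs B (\<lambda>t u. fst (riccati A Chart1 t u))"
        by (rule polynomial_with_holomorphic_coeffs_quadratic
            [where ?c0.0="A 0 1" and ?c1.0="\<lambda>t. A 0 0 t - A 1 1 t" and ?c2.0="A 0 2"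
              and ?c3.0="\<lambda>t. - A 1 0 t" and ?c4.0="\<lambda>t. - A 1 2 t" and ?c5.0="\<lambda>_. 0"])
          (rule h | simp add: Let_def algebra_simps power2_eq_square)+
      show "polynomial_with_holomorphic_coeffs B (\<lambda>t u. snd (riccati A Chart1 t u))"
        by (rule polynomial_with_holomorphic_coeffs_quadratic
            [where ?c0.0="A 2 1" and ?c1.0="A 2 0" and ?c2.0="\<lambda>t. A 2 2 t - A 1 1 t"
              and ?c3.0="\<lambda>_. 0" and ?c4.0="\<lambda>t. - A 1 0 t" and ?c5.0="\<lambda>t. - A 1 2 t"])
          (rule h | simp add: Let_def algebra_simps power2_eq_square)+
    qed
  next
    case Chart2
    show ?thesis
      unfolding Chart2 polynomial_system_def
    proof
      show "polynomial_with_holomorphic_coeffs B (\<lambda>t u. fst (riccati A Chart2 t u))"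
        by (rule polynomial_with_holomorphic_coeffs_quadratic
            [where ?c0.0="A 1 2" and ?c1.0="\<lambda>t. A 1 1 t - A 2 2 t" and ?c2.0="A 1 0"
              and ?c3.0="\<lambda>t. - A 2 1 t" and ?c4.0="\<lambda>t. - A 2 0 t" and ?c5.0="\<lambda>_. 0"])
          (rule h | simp add: Let_def algebra_simps power2_eq_square)+
      show "polynomial_with_holomorphic_coeffs B (\<lambda>t u. snd (riccati A Chart2 t u))"
        by (rule polynomial_with_holomorphic_coeffs_quadratic
            [where ?c0.0="A 0 2" and ?c1.0="A 0 1" and ?c2.0="\<lambda>t. A 0 0 t - A 2 2 t"
              and ?c3.0="\<lambda>_. 0" and ?c4.0="\<lambda>t. - A 2 1 t" and ?c5.0="\<lambda>t. - A 2 0 t"])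
          (rule h | simp add: Let_def algebra_simps power2_eq_square)+
    qed
  qed
qed

text \<open>All three systems come from the same linear flow: by the quotient rule the derivative of
  \<open>zi / zj\<close> is homogeneous of degree 0 in \<open>z\<close>, hence one vector field on
  the plane read in different charts.\<close>

lemma rewritten_as_riccati: "rewritten_as B j (riccati A j) k (riccati A k)"
proof -
  have coord: "chart_coord Chart1 (chart_point Chart0 v) = (1 / fst v, snd v / fst v)"
    "chart_coord Chart2 (chart_point Chart0 v) = (fst v / snd v, 1 / snd v)"
    "chart_coord Chart0 (chart_point Chart1 v) = (1 / fst v, snd v / fst v)"
    "chart_coord Chart2 (chart_point Chart1 v) = (1 / snd v, fst v / snd v)"
    "chart_coord Chart0 (chart_point Chart2 v) = (fst v / snd v, 1 / snd v)"
    "chart_coord Chart1 (chart_point Chart2 v) = (snd v / fst v, 1 / fst v)" for v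
    by (cases v; simp add: affine_chart_coord chart_coord_chart_point_transition)+
  have dom: "chart_dom Chart1 (chart_point Chart0 v) \<longleftrightarrow> fst v \<noteq> 0"
    "chart_dom Chart2 (chart_point Chart0 v) \<longleftrightarrow> snd v \<noteq> 0"
    "chart_dom Chart0 (chart_point Chart1 v) \<longleftrightarrow> fst v \<noteq> 0"
    "chart_dom Chart2 (chart_point Chart1 v) \<longleftrightarrow> snd v \<noteq> 0"
    "chart_dom Chart0 (chart_point Chart2 v) \<longleftrightarrow> snd v \<noteq> 0"
    "chart_dom Chart1 (chart_point Chart2 v) \<longleftrightarrow> fst v \<noteq> 0" for v
    by (cases v; simp add: affine_chart_dom chart_dom_chart_point_iff)+
  note derivs = has_derivative_inverse_fst has_derivative_inverse_snd
    has_derivative_snd_div_fst has_derivative_fst_div_snd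
  note arith = Let_def power2_eq_square field_simps
  consider "j = k" | "j = Chart0" "k = Chart1" | "j = Chart0" "k = Chart2"
    | "j = Chart1" "k = Chart0" | "j = Chart1" "k = Chart2"
    | "j = Chart2" "k = Chart0" | "j = Chart2" "k = Chart1"
    by (cases j; cases k) auto
  then show ?thesis
    \<comment> \<open>Off the diagonal, the derivative rules supply \<open>D1\<close> and
      \<open>D2\<close>; what remains is a rational identity in the chart coordinates and the
      entries of \<open>A\<close>, settled by clearing denominators.\<close>
    by cases
      (simp only: rewritten_as_refl,
        (simp only:, rule rewritten_asI; unfold coord dom fst_conv snd_conv;
          (rule derivs; assumption)?; simp add: split_paired_all arith)+)
qed

section \<open>Extending meromorphic functions into the plane\<close>

text \<open>A singularity that is not essential has a finite limit or is a pole, and at a pole the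
  reciprocal tends to 0; either way a removable singularity remains. Equalities hold only on a
  punctured neighbourhood, since the value at \<open>z\<close> is arbitrary.\<close>

lemma meromorphic_at_cases:
  assumes "f meromorphic_on {z}"
  obtains (removable) g where "g analytic_on {z}" "eventually (\<lambda>w. f w = g w) (at z)"
  | (pole) g where "g analytic_on {z}" "eventually (\<lambda>w. inverse (f w) = g w) (at z)"
      "eventually (\<lambda>w. f w \<noteq> 0) (at z)"
proof -
  have sing: "isolated_singularity_at h z" if "h meromorphic_on {z}" for h
    using that by (simp add: meromorphic_at_iff)
  have rem: "\<exists>g. g analytic_on {z} \<and> eventually (\<lambda>w. h w = g w) (at z)"
    if "h meromorphic_on {z}" "h \<midarrow>z\<rightarrow> c" for h c
    using remove_sings_analytic_at[OF sing that(2)] eventually_remove_sings_eq_at[OF sing] that(1)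
    by (intro exI[of _ "remove_sings h"]) (auto simp: eq_commute)
  consider c where "f \<midarrow>z\<rightarrow> c" | "is_pole f z"
    using assms by (auto simp: meromorphic_at_iff not_essential_def)
  then show thesis
  proof cases
    case 1
    then show thesis using rem[OF assms] removable by blast
  next
    case 2
    then have "(\<lambda>w. inverse (f w)) \<midarrow>z\<rightarrow> 0"
      unfolding is_pole_def by (rule filterlim_compose[OF tendsto_inverse_0])
    moreover have "eventually (\<lambda>w. f w \<noteq> 0) (at z)"
      using 2 by (rule non_zero_neighbour_pole)
    ultimately show thesis
      using rem[OF meromorphic_on_inverse[OF assms]] pole by blast
  qed
qed

text \<open>The poles select the chart: \<open>Chart0\<close> if neither component has one,
  \<open>Chart2\<close> if only \<open>y\<close> has one. If \<open>x\<close> has a pole,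
  \<open>y / x\<close> decides between \<open>Chart1\<close> and \<open>Chart2\<close>.\<close>

lemma meromorphic_pair_chart:
  assumes x: "x meromorphic_on {z}" and y: "y meromorphic_on {z}"
  obtains k u v where "u analytic_on {z}" "v analytic_on {z}"
    "eventually (\<lambda>w. chart_point k (u w, v w) = chart_point Chart0 (x w, y w)) (at z)"
proof -
  note split = meromorphic_at_cases
  have yx: "(\<lambda>w. y w / x w) meromorphic_on {z}"
    by (intro meromorphic_on_divide x y)
  show thesis
  proof (cases rule: split[OF x])
    case x': (1 g)
    show thesis
    proof (cases rule: split[OF y])
      case (1 h)
      show thesis
        by (rule that[OF x'(1) 1(1), of Chart0]) (use x'(2) 1(2) in eventually_elim, simp)
    next
      case (2 h)
      have "(\<lambda>w. g w * h w) analytic_on {z}"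
        by (intro analytic_on_mult x' 2)
      then show thesis
      proof (rule that[OF _ 2(1), of _ Chart2])
        show "\<forall>\<^sub>F w in at z. chart_point Chart2 (g w * h w, h w) = chart_point Chart0 (x w, y w)"
          using x'(2) 2(2,3)
          by eventually_elim (metis chart_point_Chart2_inverse divide_inverse mult_1)
      qed
    qed
  next
    case x': (2 g)
    \<comment> \<open>With a pole of \<open>x\<close>, the size of \<open>y\<close> alone is not
      decisive; \<open>y / x\<close> has a pole exactly when \<open>y\<close> dominates
      \<open>x\<close>.\<close>
    show thesis
    proof (cases rule: split[OF yx])
      case (1 h)
      show thesis
      proof (rule that[OF x'(1) 1(1), of Chart1])
        show "\<forall>\<^sub>F w in at z. chart_point Chart1 (g w, h w) = chart_point Chart0 (x w, y w)"
          using x'(2,3) 1(2)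
          by eventually_elim (metis chart_point_Chart1_inverse divide_inverse mult_1)
      qed
    next
      \<comment> \<open>Near \<open>z\<close>, \<open>g\<close> is \<open>1 / x\<close> and
        \<open>h\<close> is \<open>x / y\<close>, so the second coordinate \<open>1 / y\<close> of
        \<open>Chart2\<close> is their product.\<close>
      case (2 h)
      have "(\<lambda>w. g w * h w) analytic_on {z}"
        by (intro analytic_on_mult x' 2)
      then show thesis
      proof (rule that[OF 2(1), of _ Chart2])
        show "\<forall>\<^sub>F w in at z. chart_point Chart2 (h w, g w * h w) = chart_point Chart0 (x w, y w)"
          using x'(2,3) 2(2,3)
        proof eventually_elim
          case (elim w)
          then have "y w \<noteq> 0" "h w = x w / y w" "g w * h w = 1 / y w"
            by (auto simp: field_simps)
          then show ?case by (simp add: chart_point_Chart2_inverse)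
        qed
      qed
    qed
  qed
qed

text \<open>The local extensions fit together because near any point each of them agrees, off that
  point, with the affine curve \<open>aff\<close>.\<close>

lemma meromorphic_extends_into_plane:
  assumes U: "open U" and x: "x meromorphic_on U" and y: "y meromorphic_on U"
  shows "extends_into_plane U x y"
proof -
  define ana where "ana z \<longleftrightarrow> x analytic_on {z} \<and> y analytic_on {z}" for z
  define aff where "aff z = chart_point Chart0 (x z, y z)" for z
  \<comment> \<open>The last conjunct pins down the value at the centre when both components are
    analytic there, which agreement on a punctured neighbourhood does not state.\<close>
  define good where "good z k u v \<longleftrightarrow> u analytic_on {z} \<and> v analytic_on {z} \<and>
      eventually (\<lambda>w. chart_point k (u w, v w) = aff w) (at z) \<and>
      (ana z \<longrightarrow> chart_point k (u z, v z) = aff z)" for z k u v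
  have "\<exists>k u v. good z k u v" if z: "z \<in> U" for z
  proof (cases "ana z")
    case True
    then have "good z Chart0 x y"
      by (simp add: good_def ana_def aff_def)
    then show ?thesis by blast
  next
    case False
    have "x meromorphic_on {z}" "y meromorphic_on {z}"
      using x y z by (auto intro: meromorphic_on_subset)
    then show ?thesis
      by (rule meromorphic_pair_chart) (use False in \<open>auto simp: good_def aff_def\<close>)
  qed
  then obtain k u v where "\<And>z. z \<in> U \<Longrightarrow> good z (k z) (u z) (v z)"
    by metis
  note kuv = this[unfolded good_def]
  \<comment> \<open>Each point uses its own chart and germs, evaluated only at their centre;
    holomorphy is therefore still to be shown.\<close>
  define \<Phi> where "\<Phi> z = chart_point (k z) (u z z, v z z)" for z
  have \<Phi>_ana: "\<Phi> z = aff z" if "z \<in> U" "ana z" for z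
    using kuv[OF that(1)] that(2) by (simp add: \<Phi>_def)
  have "holomorphic_into_plane U \<Phi>"
    unfolding holomorphic_into_plane_def
  proof
    fix z assume z: "z \<in> U"
    \<comment> \<open>Points where a meromorphic function fails to be analytic do not accumulate in
      \<open>U\<close>, so around \<open>z\<close> the map \<open>\<Phi>\<close> is
      \<open>aff\<close>, which the germs chosen at \<open>z\<close> represent.\<close>
    have "eventually (\<lambda>w. x analytic_on {w}) (at z)" "eventually (\<lambda>w. y analytic_on {w}) (at z)"
      using meromorphic_on_imp_not_islimpt_singularities[OF x z]
        meromorphic_on_imp_not_islimpt_singularities[OF y z]
      by (auto simp: islimpt_iff_eventually)
    moreover have "eventually (\<lambda>w. w \<in> U) (at z)"
      using U z by (rule eventually_at_in_open')
    moreover have "eventually (\<lambda>w. chart_point (k z) (u z w, v z w) = aff w) (at z)"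
      using kuv[OF z] by simp
    ultimately have "eventually (\<lambda>w. w \<in> U \<and> \<Phi> w = chart_point (k z) (u z w, v z w)) (at z)"
      by eventually_elim (simp add: \<Phi>_ana ana_def)
    \<comment> \<open>At the centre itself the equality is the definition of
      \<open>\<Phi>\<close>.\<close>
    then have "eventually (\<lambda>w. w \<in> U \<and> \<Phi> w = chart_point (k z) (u z w, v z w)) (nhds z)"
      using z by (auto simp: eventually_nhds_conv_at \<Phi>_def)
    then obtain V1 where V1: "open V1" "z \<in> V1"
        "\<And>w. w \<in> V1 \<Longrightarrow> w \<in> U \<and> \<Phi> w = chart_point (k z) (u z w, v z w)"
      by (auto simp: eventually_nhds)
    obtain V2 where V2: "open V2" "z \<in> V2" "u z holomorphic_on V2"
      using kuv[OF z] by (auto simp: analytic_at)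
    obtain V3 where V3: "open V3" "z \<in> V3" "v z holomorphic_on V3"
      using kuv[OF z] by (auto simp: analytic_at)
    define V where "V = V1 \<inter> V2 \<inter> V3"
    have \<Phi>_eq: "\<Phi> w = chart_point (k z) (u z w, v z w)" if "w \<in> V" for w
      using V1(3) that by (auto simp: V_def)
    have "u z holomorphic_on V" "v z holomorphic_on V"
      using V2(3) V3(3) by (auto simp: V_def intro: holomorphic_on_subset)
    then have "(\<lambda>w. fst (chart_coord (k z) (\<Phi> w))) holomorphic_on V"
      "(\<lambda>w. snd (chart_coord (k z) (\<Phi> w))) holomorphic_on V"
      by (auto simp: \<Phi>_eq chart_coord_chart_point cong: holomorphic_cong)
    moreover have "open V" "z \<in> V" "V \<subseteq> U" "\<forall>w\<in>V. chart_dom (k z) (\<Phi> w)"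
      using V1 V2 V3 by (auto simp: V_def \<Phi>_eq chart_dom_chart_point)
    ultimately show "\<exists>k V. open V \<and> z \<in> V \<and> V \<subseteq> U \<and> (\<forall>s\<in>V. chart_dom k (\<Phi> s)) \<and>
        (\<lambda>s. fst (chart_coord k (\<Phi> s))) holomorphic_on V \<and>
        (\<lambda>s. snd (chart_coord k (\<Phi> s))) holomorphic_on V"
      by blast
  qed
  then show ?thesis
    unfolding extends_into_plane_def using \<Phi>_ana by (auto simp: ana_def aff_def)
qed

section \<open>The linear system behind the given equations\<close>

theorem proposition24p2:
  fixes B :: "complex set" and q r :: "complex \<Rightarrow> complex"
  assumes "open B" and "connected B" and "B \<noteq> {}"
    and "q holomorphic_on B" and "r holomorphic_on B"
    and "\<And>t. t \<in> B \<Longrightarrow> q t \<noteq> 0"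
  shows "phase_space_is_proj_plane B
    (\<lambda>t (x, y).
      (- q t * x\<^sup>2 - r t * x * y - deriv q t / (2 * q t) * x + y + r t / (2 * q t),
       - r t * y\<^sup>2 - q t * x * y - deriv q t / (2 * q t) * y + 1 / 2))"
    (is "phase_space_is_proj_plane B ?F")
proof -
  \<comment> \<open>The quadratic part \<open>- x * (q * x + r * y)\<close>,
    \<open>- y * (q * x + r * y)\<close> dictates row 0. Adding a multiple of the identity to
    \<open>A\<close> leaves the induced system unchanged, and the choice \<open>A 0 0 = 0\<close>
    lets rows 1 and 2 be read off from the affine terms.\<close>
  define A :: "nat \<Rightarrow> nat \<Rightarrow> complex \<Rightarrow> complex" where "A i j =
    (if (i, j) = (0, 1) then q else if (i, j) = (0, 2) then r
     else if (i, j) = (1, 0) then (\<lambda>t. r t / (2 * q t)) else if (i, j) = (1, 2) then (\<lambda>_. 1)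
     else if (i, j) = (2, 0) then (\<lambda>_. 1 / 2)
     else if (i, j) \<in> {(1, 1), (2, 2)} then (\<lambda>t. - (deriv q t / (2 * q t))) else (\<lambda>_. 0))" for i j
  have "A i j holomorphic_on B" for i j
  proof -
    have "(\<lambda>t. r t / (2 * q t)) holomorphic_on B" "(\<lambda>t. - (deriv q t / (2 * q t))) holomorphic_on B"
      by (intro holomorphic_intros holomorphic_deriv assms; simp add: assms(6))+
    then show ?thesis
      using assms(4,5) by (simp add: A_def)
  qed
  then have "polynomial_system B (riccati A k)" for k
    by (rule polynomial_system_riccati)
  moreover have "riccati A Chart0 t u = ?F t u" for t u
    by (cases u) (simp add: A_def Let_def power2_eq_square algebra_simps)
  ultimately have "\<exists>G. (\<forall>t\<in>B. \<forall>u. G Chart0 t u = ?F t u) \<and>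
      (\<forall>k. polynomial_system B (G k)) \<and> (\<forall>j k. rewritten_as B j (G j) k (G k))"
    using rewritten_as_riccati by (intro exI[of _ "riccati A"]) blast
  then show ?thesis
    unfolding phase_space_is_proj_plane_def
    using meromorphic_extends_into_plane by (auto simp: meromorphic_solution_def)
qed

end
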